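(* Let $X$, $A$, $\phi_\alpha$, $b_\alpha$, $\mathcal P$, $E$, $A(p)$, $\mathcal H(p)$, $s_\alpha$, $\ell_k(p)$, $q_k(p)$, $x^n(p)$, the norms $\|\cdot\|_{\ell_k(p)}$ and the Simplex Algorithm be as in the context, and let $c:X\to\mathbb R$ be a continuous linear functional. Suppose that: (i) $\mathcal P$ is non-empty and compact; (ii) for all $p\in E$ and all $\alpha\in A(p)$, the set $\bigcap_{\alpha'\in A(p),\,\alpha'\ne\alpha}H_{\alpha'}$ strictly contains $\{p\}$; moreover $\rho:=\inf_{p\in E,\ \alpha\in A\setminus A(p)}s_\alpha(p)>0$; (iii) for all $p\in E$ and all $r\in\mathcal H(p)-p$, $\sup_{\alpha\in A\setminus A(p)}\phi_\alpha(r)<\infty$; (iv) $A$ is countable; (v) for all $p\in E$ and $x\in X$, the set $\{x^n(p): n=1,2,\dots\}$ lies in a compact set (which may depend on $x$ and $p$ but not on $n$); (vi) $\inf_{p\in E,\,k}\|q_k(p)-p\|_{\ell_k(p)}>0$ and $\sup_{p\in E,\,k}\|q_k(p)-p\|_{\ell_k(p)}<\infty$; (vii) for each $p\in E$ the infimum $\gamma(p)=\inf_{k}\frac{c(q_k(p))-c(p)}{\|q_k(p)-p\|_{\ell_k(p)}}$ is attained; (viii) $\sup_{p\in E,\ \alpha\in A}|\phi_\alpha(p)|<\infty$; (ix) the series $\sum_{k=1}^\infty|c(q_k(p)-p)|$ converges uniformly over $p\in E$. Then, for the problem of minimizing $c$ over $\mathcal P$ and for any starting extreme point, either the Simplex Algorithm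 terminates with an optimal solution, or the infinite sequence of extreme points $(p^n)$ it generates converges in value to optimality, i.e. $\lim_{n\to\infty}c(p^n)=c^*$, where $c^*=c(x^* )$ and $x^*$ is a minimizer of $c$ over $\mathcal P$.
   Context: $X$ is a real locally convex Hausdorff topological vector space. $A$ is an index set; for each $\alpha\in A$, $\phi_\alpha$ is a non-zero continuous linear functional on $X$, $b_\alpha\in\mathbb R$, $H_\alpha=\{x\in X:\phi_\alpha(x)=b_\alpha\}$, $S_\alpha=\{x\in X:\phi_\alpha(x)\le b_\alpha\}$, and $\mathcal P=\bigcap_{\alpha\in A}S_\alpha$, assumed not to be a singleton. $E$ is the set of extreme points of $\mathcal P$. For $p\in\mathcal P$: $A(p)=\{\alpha\in A: p\in H_\alpha\}$, $\mathcal H(p)=\bigcap_{\alpha\in A(p)}H_\alpha$ (equal to $X$ if $A(p)=\emptyset$), and $s_\alpha(p)=b_\alpha-\phi_\alpha(p)$. Since $A$ is countable, for each $p\in E$ fix an enumeration $k=1,2,\dots$ of $A(p)$ and write $\phi_k(\cdot;p)$, $H_k$, $S_k$ for the functional, hyperplane and halfspace of the $k$-th active constraint at $p$ (if $A(p)$ is finite, $k$ runs over finitely many values and series are the corresponding finite sums). For $p\in E$ and an index $k$ of $A(p)$, $\ell_k(p)$ is the intersection of all $H_{\alpha'}$, $\alpha'\in A(p)$, other than the $k$-th one; under hypotheses (i)-(iii) it is a line through $p$. The set $\ell_k(p)\cap S_k$ is a half-line $\{p+\lambda t:\lambda\ge0\}$ for some $t\neq 0$. Put $q_k(p)=p+\lambda^*t$,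 where $\lambda^*=\max\{\lambda\ge0: p+\lambda t\in S_\beta \text{ for every }\beta\in A\setminus A(p)\text{ such that }H_\beta\text{ meets this half-line}\}$; $q_k(p)$ is the $k$-th adjacent extreme point of $p$. For $x\in X$ and $p\in E$, let $x_k(p)$ be the unique vector $y$ in the one-dimensional subspace $\ell_k(p)-p$ with $\phi_k(y;p)=\phi_k(x-p;p)$, and $x^n(p)=\sum_{k=1}^n x_k(p)$. For each $p\in E$ and $k$, $\|\cdot\|_{\ell_k(p)}$ is a fixed (arbitrarily chosen) norm on the one-dimensional vector space $\ell_k(p)-p$. Simplex Algorithm: start with some $p^0\in E$. At iteration $n$, with $\gamma(p)=\min_k\frac{c(q_k(p))-c(p)}{\|q_k(p)-p\|_{\ell_k(p)}}$: if $\gamma(p^n)\ge0$, terminate with output $p^n$; if $\gamma(p^n)<0$, choose an index $k$ attaining the minimum $\gamma(p^n)$, set $p^{n+1}=q_k(p^n)$, and continue with $n+1$. *)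

theory Defs
  imports "HOL-Analysis.Analysis"
begin

class topological_real_vector = topological_ab_group_add + real_vector +
  assumes tendsto_scaleR_Pair:
    "LIM p (nhds a \<times>\<^sub>F nhds x). fst p *\<^sub>R snd p :> nhds (a *\<^sub>R x)"

(* Convexity of V is spelled out: the constant convex (on real_vector) cannot be used in a class
   specification; see locally_convex below. *)
class locally_convex_t2_space = topological_real_vector + t2_space +
  assumes locally_convex_unfolded:
    "open U \<Longrightarrow> 0 \<in> U \<Longrightarrow> \<exists>V. open V \<and>
      (\<forall>x\<in>V. \<forall>y\<in>V. \<forall>u\<ge>0. \<forall>v\<ge>0. u + v = 1 \<longrightarrow> u *\<^sub>R x + v *\<^sub>R y \<in> V) \<and> 0 \<in> V \<and> V \<subseteq> U"

lemma locally_convex: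
  fixes U :: "'a::locally_convex_t2_space set"
  shows "open U \<Longrightarrow> 0 \<in> U \<Longrightarrow> \<exists>V. open V \<and> convex V \<and> 0 \<in> V \<and> V \<subseteq> U"
  unfolding convex_def by (rule locally_convex_unfolded)

instance real_normed_vector \<subseteq> locally_convex_t2_space
proof
  fix a :: real and x :: 'a
  have "((\<lambda>p. fst p *\<^sub>R snd p) \<longlongrightarrow> fst (a, x) *\<^sub>R snd (a, x)) (nhds (a, x))"
    by (intro tendsto_scaleR tendsto_fst tendsto_snd filterlim_ident)
  then show "LIM p (nhds a \<times>\<^sub>F nhds x). fst p *\<^sub>R snd p :> nhds (a *\<^sub>R x)"
    by (simp add: nhds_prod)
next
  fix U :: "'a set"
  assume "open U" "0 \<in> U"
  then obtain e where "e > 0" "ball 0 e \<subseteq> U"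
    by (auto simp: open_contains_ball)
  then have "open (ball (0::'a) e) \<and> convex (ball (0::'a) e) \<and> 0 \<in> ball (0::'a) e \<and> ball 0 e \<subseteq> U"
    by auto
  then show "\<exists>V. open V \<and>
      (\<forall>x\<in>V. \<forall>y\<in>V. \<forall>u\<ge>0. \<forall>v\<ge>0. u + v = 1 \<longrightarrow> u *\<^sub>R x + v *\<^sub>R y \<in> V) \<and> 0 \<in> V \<and> V \<subseteq> U"
    unfolding convex_def by blast
qed

definition hyperplane :: "('i \<Rightarrow> 'a \<Rightarrow> real) \<Rightarrow> ('i \<Rightarrow> real) \<Rightarrow> 'i \<Rightarrow> 'a set" where
  "hyperplane \<phi> b \<alpha> = {x. \<phi> \<alpha> x = b \<alpha>}"

definition halfspace :: "('i \<Rightarrow> 'a \<Rightarrow> real) \<Rightarrow> ('i \<Rightarrow> real) \<Rightarrow> 'i \<Rightarrow> 'a set" where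
  "halfspace \<phi> b \<alpha> = {x. \<phi> \<alpha> x \<le> b \<alpha>}"

definition feasible :: "'i set \<Rightarrow> ('i \<Rightarrow> 'a \<Rightarrow> real) \<Rightarrow> ('i \<Rightarrow> real) \<Rightarrow> 'a set" where
  "feasible A \<phi> b = (\<Inter>\<alpha>\<in>A. halfspace \<phi> b \<alpha>)"

definition extreme_points :: "'i set \<Rightarrow> ('i \<Rightarrow> 'a::real_vector \<Rightarrow> real) \<Rightarrow> ('i \<Rightarrow> real) \<Rightarrow> 'a set" where
  "extreme_points A \<phi> b = {p. p extreme_point_of feasible A \<phi> b}"

definition active :: "'i set \<Rightarrow> ('i \<Rightarrow> 'a \<Rightarrow> real) \<Rightarrow> ('i \<Rightarrow> real) \<Rightarrow> 'a \<Rightarrow> 'i set" where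
  "active A \<phi> b p = {\<alpha> \<in> A. p \<in> hyperplane \<phi> b \<alpha>}"

definition active_flat :: "'i set \<Rightarrow> ('i \<Rightarrow> 'a \<Rightarrow> real) \<Rightarrow> ('i \<Rightarrow> real) \<Rightarrow> 'a \<Rightarrow> 'a set" where
  "active_flat A \<phi> b p = (\<Inter>\<alpha>\<in>active A \<phi> b p. hyperplane \<phi> b \<alpha>)"

definition slack :: "('i \<Rightarrow> 'a \<Rightarrow> real) \<Rightarrow> ('i \<Rightarrow> real) \<Rightarrow> 'i \<Rightarrow> 'a \<Rightarrow> real" where
  "slack \<phi> b \<alpha> p = b \<alpha> - \<phi> \<alpha> p"

(* Positions 1, 2, ... used in an enumeration without repetition of a countable set S. *)
definition positions :: "'i set \<Rightarrow> nat set" where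
  "positions S = (if finite S then {1..card S} else {1..})"

definition enumeration :: "'i set \<Rightarrow> (nat \<Rightarrow> 'i) \<Rightarrow> bool" where
  "enumeration S f \<longleftrightarrow> bij_betw f (positions S) S"

(* In what follows e p k is the k-th active constraint at p, for k \<in> indices A \<phi> b p. *)

definition indices :: "'i set \<Rightarrow> ('i \<Rightarrow> 'a \<Rightarrow> real) \<Rightarrow> ('i \<Rightarrow> real) \<Rightarrow> 'a \<Rightarrow> nat set" where
  "indices A \<phi> b p = positions (active A \<phi> b p)"

definition edge_line ::
  "'i set \<Rightarrow> ('i \<Rightarrow> 'a \<Rightarrow> real) \<Rightarrow> ('i \<Rightarrow> real) \<Rightarrow> ('a \<Rightarrow> nat \<Rightarrow> 'i) \<Rightarrow> 'a \<Rightarrow> nat \<Rightarrow> 'a set" where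
  "edge_line A \<phi> b e p k = (\<Inter>\<alpha>\<in>active A \<phi> b p - {e p k}. hyperplane \<phi> b \<alpha>)"

definition edge_space ::
  "'i set \<Rightarrow> ('i \<Rightarrow> 'a::real_vector \<Rightarrow> real) \<Rightarrow> ('i \<Rightarrow> real) \<Rightarrow> ('a \<Rightarrow> nat \<Rightarrow> 'i) \<Rightarrow> 'a \<Rightarrow> nat \<Rightarrow> 'a set" where
  "edge_space A \<phi> b e p k = (\<lambda>z. z - p) ` edge_line A \<phi> b e p k"

definition edge_ray ::
  "'i set \<Rightarrow> ('i \<Rightarrow> 'a \<Rightarrow> real) \<Rightarrow> ('i \<Rightarrow> real) \<Rightarrow> ('a \<Rightarrow> nat \<Rightarrow> 'i) \<Rightarrow> 'a \<Rightarrow> nat \<Rightarrow> 'a set" where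
  "edge_ray A \<phi> b e p k = edge_line A \<phi> b e p k \<inter> halfspace \<phi> b (e p k)"

(* The direction is unique up to a positive factor, on which adjacent below does not depend. *)
definition edge_direction ::
  "'i set \<Rightarrow> ('i \<Rightarrow> 'a::real_vector \<Rightarrow> real) \<Rightarrow> ('i \<Rightarrow> real) \<Rightarrow> ('a \<Rightarrow> nat \<Rightarrow> 'i) \<Rightarrow> 'a \<Rightarrow> nat \<Rightarrow> 'a" where
  "edge_direction A \<phi> b e p k =
    (SOME t. t \<noteq> 0 \<and> edge_ray A \<phi> b e p k = {p + l *\<^sub>R t | l. 0 \<le> l})"

definition edge_step ::
  "'i set \<Rightarrow> ('i \<Rightarrow> 'a::real_vector \<Rightarrow> real) \<Rightarrow> ('i \<Rightarrow> real) \<Rightarrow> ('a \<Rightarrow> nat \<Rightarrow> 'i) \<Rightarrow> 'a \<Rightarrow> nat \<Rightarrow> real" where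
  "edge_step A \<phi> b e p k =
    (GREATEST l. 0 \<le> l \<and>
      (\<forall>\<beta>\<in>A - active A \<phi> b p. hyperplane \<phi> b \<beta> \<inter> edge_ray A \<phi> b e p k \<noteq> {} \<longrightarrow>
        p + l *\<^sub>R edge_direction A \<phi> b e p k \<in> halfspace \<phi> b \<beta>))"

definition adjacent ::
  "'i set \<Rightarrow> ('i \<Rightarrow> 'a::real_vector \<Rightarrow> real) \<Rightarrow> ('i \<Rightarrow> real) \<Rightarrow> ('a \<Rightarrow> nat \<Rightarrow> 'i) \<Rightarrow> 'a \<Rightarrow> nat \<Rightarrow> 'a" where
  "adjacent A \<phi> b e p k = p + edge_step A \<phi> b e p k *\<^sub>R edge_direction A \<phi> b e p k"

definition edge_component ::
  "'i set \<Rightarrow> ('i \<Rightarrow> 'a::real_vector \<Rightarrow> real) \<Rightarrow> ('i \<Rightarrow> real) \<Rightarrow> ('a \<Rightarrow> nat \<Rightarrow> 'i) \<Rightarrow> 'a \<Rightarrow> 'a \<Rightarrow> nat \<Rightarrow> 'a" where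
  "edge_component A \<phi> b e x p k =
    (THE y. y \<in> edge_space A \<phi> b e p k \<and> \<phi> (e p k) y = \<phi> (e p k) (x - p))"

definition edge_partial_sum ::
  "'i set \<Rightarrow> ('i \<Rightarrow> 'a::real_vector \<Rightarrow> real) \<Rightarrow> ('i \<Rightarrow> real) \<Rightarrow> ('a \<Rightarrow> nat \<Rightarrow> 'i) \<Rightarrow> 'a \<Rightarrow> 'a \<Rightarrow> nat \<Rightarrow> 'a" where
  "edge_partial_sum A \<phi> b e x p n =
    (\<Sum>k\<in>{1..n} \<inter> indices A \<phi> b p. edge_component A \<phi> b e x p k)"

definition norm_on :: "'a::real_vector set \<Rightarrow> ('a \<Rightarrow> real) \<Rightarrow> bool" where
  "norm_on V N \<longleftrightarrow>
    (\<forall>v\<in>V. 0 \<le> N v \<and> (N v = 0 \<longleftrightarrow> v = 0)) \<and>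
    (\<forall>a. \<forall>v\<in>V. N (a *\<^sub>R v) = \<bar>a\<bar> * N v) \<and>
    (\<forall>u\<in>V. \<forall>v\<in>V. N (u + v) \<le> N u + N v)"

(* In what follows N p k is the norm chosen on edge_space A \<phi> b e p k. *)

definition edge_length ::
  "'i set \<Rightarrow> ('i \<Rightarrow> 'a::real_vector \<Rightarrow> real) \<Rightarrow> ('i \<Rightarrow> real) \<Rightarrow> ('a \<Rightarrow> nat \<Rightarrow> 'i) \<Rightarrow>
    ('a \<Rightarrow> nat \<Rightarrow> 'a \<Rightarrow> real) \<Rightarrow> 'a \<Rightarrow> nat \<Rightarrow> real" where
  "edge_length A \<phi> b e N p k = N p k (adjacent A \<phi> b e p k - p)"

definition cost_rate ::
  "'i set \<Rightarrow> ('i \<Rightarrow> 'a::real_vector \<Rightarrow> real) \<Rightarrow> ('i \<Rightarrow> real) \<Rightarrow> ('a \<Rightarrow> nat \<Rightarrow> 'i) \<Rightarrow>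
    ('a \<Rightarrow> nat \<Rightarrow> 'a \<Rightarrow> real) \<Rightarrow> ('a \<Rightarrow> real) \<Rightarrow> 'a \<Rightarrow> nat \<Rightarrow> real" where
  "cost_rate A \<phi> b e N c p k = (c (adjacent A \<phi> b e p k) - c p) / edge_length A \<phi> b e N p k"

(* Extended-real valued, so that the infimum makes sense before it is known to be attained. *)
definition best_rate ::
  "'i set \<Rightarrow> ('i \<Rightarrow> 'a::real_vector \<Rightarrow> real) \<Rightarrow> ('i \<Rightarrow> real) \<Rightarrow> ('a \<Rightarrow> nat \<Rightarrow> 'i) \<Rightarrow>
    ('a \<Rightarrow> nat \<Rightarrow> 'a \<Rightarrow> real) \<Rightarrow> ('a \<Rightarrow> real) \<Rightarrow> 'a \<Rightarrow> ereal" where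
  "best_rate A \<phi> b e N c p = (INF k\<in>indices A \<phi> b p. ereal (cost_rate A \<phi> b e N c p k))"

definition simplex_step ::
  "'i set \<Rightarrow> ('i \<Rightarrow> 'a::real_vector \<Rightarrow> real) \<Rightarrow> ('i \<Rightarrow> real) \<Rightarrow> ('a \<Rightarrow> nat \<Rightarrow> 'i) \<Rightarrow>
    ('a \<Rightarrow> nat \<Rightarrow> 'a \<Rightarrow> real) \<Rightarrow> ('a \<Rightarrow> real) \<Rightarrow> 'a \<Rightarrow> 'a \<Rightarrow> bool" where
  "simplex_step A \<phi> b e N c p q \<longleftrightarrow>
    best_rate A \<phi> b e N c p < 0 \<and>
    (\<exists>k\<in>indices A \<phi> b p. ereal (cost_rate A \<phi> b e N c p k) = best_rate A \<phi> b e N c p \<and>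
      q = adjacent A \<phi> b e p k)"

(* A run performs L steps, visiting s 0, ..., s L (all s n if L = \<infinity>). It is maximal: it may stop
   only where no step is possible. Stopping because no index attains a negative best_rate is
   not excluded here, so that "stops only with best_rate \<ge> 0" remains part of any claim. *)
definition simplex_run ::
  "'i set \<Rightarrow> ('i \<Rightarrow> 'a::real_vector \<Rightarrow> real) \<Rightarrow> ('i \<Rightarrow> real) \<Rightarrow> ('a \<Rightarrow> nat \<Rightarrow> 'i) \<Rightarrow>
    ('a \<Rightarrow> nat \<Rightarrow> 'a \<Rightarrow> real) \<Rightarrow> ('a \<Rightarrow> real) \<Rightarrow> (nat \<Rightarrow> 'a) \<Rightarrow> enat \<Rightarrow> bool" where
  "simplex_run A \<phi> b e N c s L \<longleftrightarrow>
    s 0 \<in> extreme_points A \<phi> b \<and>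
    (\<forall>n. enat n < L \<longrightarrow> simplex_step A \<phi> b e N c (s n) (s (Suc n))) \<and>
    (\<forall>m. L = enat m \<longrightarrow> (\<nexists>q. simplex_step A \<phi> b e N c (s m) q))"

end

theory Submission
  imports Defs
begin

text \<open>At an extreme point \<open>p\<close> only \<open>p\<close> itself lies on all active hyperplanes, so for feasible \<open>x\<close>
  the partial sums of the components of \<open>x - p\<close> along the edges can only cluster at \<open>x - p\<close>. Hence
  \<open>c x - c p\<close> is a limit of sums of the edge costs \<open>c (q\<^sub>k - p)\<close> with non-negative coefficients
  \<open>\<phi>\<^sub>k (x - p) / \<phi>\<^sub>k (q\<^sub>k - p)\<close>. If no edge descends, \<open>p\<close> is optimal. Otherwise take for \<open>x\<close> an optimal
  extreme point: the coefficients are then bounded uniformly in \<open>p\<close>, because the numerators are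
  differences of values at extreme points and the denominators are slacks at the adjacent extreme
  points, of size at least \<open>\<rho>\<close>. Along an infinite run the decreasing costs converge, so the best
  rates and with them the negative parts of all edge costs tend to \<open>0\<close> uniformly in \<open>k\<close>; the uniform
  convergence of the edge series turns this into \<open>c x - c p \<rightarrow> 0\<close>. The optimal extreme point is
  found without the Krein-Milman theorem: the countably many constraints separate points, so
  minimizing \<open>c\<close> and then maximizing the constraint functionals one after the other leaves a single
  point.\<close>

section \<open>Cluster points in compact sets\<close>

lemma tendsto_scaleR_topological:
  fixes g :: "'b \<Rightarrow> 'a::topological_real_vector"
  assumes "(f \<longlongrightarrow> a) F" "(g \<longlongrightarrow> x) F"
  shows "((\<lambda>n. f n *\<^sub>R g n) \<longlongrightarrow> a *\<^sub>R x) F"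
  using filterlim_compose[OF tendsto_scaleR_Pair filterlim_Pair[OF assms]] by simp

text \<open>The filter \<open>G\<close> plays the role of a convergent subsequence, which need not
  exist because the space is not assumed first countable.\<close>

lemma compact_cluster_filter:
  fixes f :: "nat \<Rightarrow> 'a::topological_space"
  assumes "compact K" "\<And>n. f n \<in> K"
  obtains y G where "y \<in> K" "G \<noteq> bot" "G \<le> sequentially" "(f \<longlongrightarrow> y) G"
proof -
  let ?F = "filtermap f sequentially"
  have "?F \<noteq> bot" "eventually (\<lambda>x. x \<in> K) ?F"
    using assms by (auto simp: filtermap_bot_iff eventually_filtermap)
  then obtain y where y: "y \<in> K" "inf (nhds y) ?F \<noteq> bot"
    using assms(1) unfolding compact_filter by blast
  \<comment> \<open>Tails of the sequence, restricted to indices whose values are close to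
    \<open>y\<close>.\<close>
  let ?G = "inf sequentially (filtercomap f (nhds y))"
  have "?G \<noteq> bot"
  proof
    assume "?G = bot"
    then have "eventually (\<lambda>x. False) ?G"
      by simp
    then obtain Q S where "eventually Q sequentially" "eventually S (nhds y)"
      and *: "\<And>n. Q n \<Longrightarrow> S (f n) \<Longrightarrow> False"
      unfolding eventually_inf eventually_filtercomap by blast
    then have "eventually (\<lambda>z. \<not> S z) ?F"
      unfolding eventually_filtermap by (metis (mono_tags, lifting) eventually_mono)
    with \<open>eventually S (nhds y)\<close> have "eventually (\<lambda>z. False) (inf (nhds y) ?F)"
      unfolding eventually_inf by blast
    with y(2) show False
      by (simp add: trivial_limit_def)
  qed
  moreover have "(f \<longlongrightarrow> y) ?G"
    using filterlim_filtercomap[of f "nhds y"] by (rule filterlim_mono) auto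
  ultimately show thesis
    using y(1) that[of y ?G] by simp
qed

text \<open>A direction of recession \<open>t\<close> is a limit of \<open>(1 / n) *\<^sub>R (n *\<^sub>R t)\<close>, where \<open>n *\<^sub>R t\<close> clusters.\<close>

lemma ray_in_compact_imp_zero:
  fixes K :: "'a::{topological_real_vector, t2_space} set"
  assumes "compact K" "\<And>n. p + real n *\<^sub>R t \<in> K"
  shows "t = 0"
proof -
  obtain y G where G: "G \<noteq> bot" "G \<le> sequentially" "((\<lambda>n. p + real n *\<^sub>R t) \<longlongrightarrow> y) G"
    by (rule compact_cluster_filter[OF assms])
  have "((\<lambda>n. (p + real n *\<^sub>R t) - p) \<longlongrightarrow> y - p) G"
    using G(3) by (intro tendsto_diff tendsto_const)
  then have "((\<lambda>n. real n *\<^sub>R t) \<longlongrightarrow> y - p) G"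
    by simp
  moreover have "((\<lambda>n. 1 / real n) \<longlongrightarrow> 0) G"
    using lim_1_over_n G(2) by (rule tendsto_mono[rotated])
  ultimately have "((\<lambda>n. (1 / real n) *\<^sub>R (real n *\<^sub>R t)) \<longlongrightarrow> 0 *\<^sub>R (y - p)) G"
    by (rule tendsto_scaleR_topological[rotated])
  \<comment> \<open>The index 0 has to be left out, since \<open>1 / real 0 = 0\<close>.\<close>
  moreover have "eventually (\<lambda>n. (1 / real n) *\<^sub>R (real n *\<^sub>R t) = t) sequentially"
    using eventually_gt_at_top[of 0] by eventually_elim simp
  then have "eventually (\<lambda>n. (1 / real n) *\<^sub>R (real n *\<^sub>R t) = t) G"
    using G(2) by (simp add: le_filter_def)
  ultimately have "((\<lambda>n. t) \<longlongrightarrow> 0) G"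
    by (simp add: tendsto_cong)
  with G(1) show ?thesis
    using tendsto_unique[OF _ tendsto_const] by blast
qed

section \<open>Extreme points as lexicographic maximizers\<close>

text \<open>\<open>f x\<close> is a convex combination, with positive weights, of two values that do
  not exceed it, so neither can lie below it.\<close>

lemma linear_open_segment_le:
  fixes f :: "'a::real_vector \<Rightarrow> real"
  assumes "linear f" "x \<in> open_segment u v" "f u \<le> f x" "f v \<le> f x"
  shows "f u = f x" "f v = f x"
proof -
  obtain w where w: "0 < w" "w < 1" "x = (1 - w) *\<^sub>R u + w *\<^sub>R v"
    using assms(2) by (auto simp: in_segment)
  then have "f x = (1 - w) * f u + w * f v"
    using assms(1) by (simp add: linear_add linear_scale)
  then have *: "(1 - w) * (f x - f u) + w * (f x - f v) = 0"
    by (simp add: algebra_simps)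
  have "0 \<le> (1 - w) * (f x - f u)" "0 \<le> w * (f x - f v)"
    using w assms by auto
  with * have "(1 - w) * (f x - f u) = 0" "w * (f x - f v) = 0"
    by linarith+
  with w show "f u = f x" "f v = f x"
    by auto
qed

text \<open>The stages \<open>F i\<close> are nested non-empty compact sets, each maximizing
  \<open>f i\<close> over the previous stage. By compactness they have a common point
  \<open>z\<close>. The end points in \<open>K\<close> of a segment through \<open>z\<close> stay in
  every stage, hence agree under all \<open>f i\<close> and coincide.\<close>

lemma extreme_point_maximizing:
  fixes K :: "'a::{real_vector, t2_space} set" and f :: "nat \<Rightarrow> 'a \<Rightarrow> real"
  assumes K: "compact K" "K \<noteq> {}"
    and f: "\<And>i. linear (f i)" "\<And>i. continuous_on UNIV (f i)"
    and sep: "\<And>x y. x \<in> K \<Longrightarrow> y \<in> K \<Longrightarrow> (\<And>i. f i x = f i y) \<Longrightarrow> x = y"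
  obtains z where "z extreme_point_of K" "\<And>y. y \<in> K \<Longrightarrow> f 0 y \<le> f 0 z"
proof -
  define M where "M g S = {x \<in> S. \<forall>y\<in>S. g y \<le> g x}" for g :: "'a \<Rightarrow> real" and S
  define F where "F = rec_nat (M (f 0) K) (\<lambda>i. M (f (Suc i)))"
  have F0: "F 0 = M (f 0) K" and FSuc: "F (Suc i) = M (f (Suc i)) (F i)" for i
    by (simp_all add: F_def)
  have M: "compact (M (f i) S) \<and> M (f i) S \<noteq> {}" if S: "compact S" "S \<noteq> {}" for i S
  proof -
    obtain x where x: "x \<in> S" "\<forall>y\<in>S. f i y \<le> f i x"
      using continuous_attains_sup[OF S continuous_on_subset[OF f(2) subset_UNIV]] by blast
    then have "M (f i) S = S \<inter> {z. f i x \<le> f i z}"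
      unfolding M_def by (auto intro: order_trans)
    moreover have "closed {z. f i x \<le> f i z}"
      using f(2) by (intro closed_Collect_le continuous_on_const)
    ultimately show ?thesis
      using S x by auto
  qed
  have F: "compact (F i) \<and> F i \<noteq> {}" for i
    by (induction i) (use M K in \<open>simp_all add: F0 FSuc\<close>)
  have dec: "F (Suc i) \<subseteq> F i" for i
    by (auto simp: FSuc M_def)
  have anti: "F j \<subseteq> F i" if "i \<le> j" for i j
    using that by (induction rule: dec_induct) (use dec in auto)
  have FK: "F i \<subseteq> K" for i
    using anti[of 0 i] by (auto simp: F0 M_def)
  have "\<exists>x. x \<in> F i" for i
    using F by blast
  then obtain x where x: "\<And>i. x i \<in> F i"
    by metis
  have "x n \<in> K" for n
    using x FK by blast
  then obtain z G where G: "G \<noteq> bot" "G \<le> sequentially" "(x \<longlongrightarrow> z) G"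
    by (rule compact_cluster_filter[OF K(1)])
  \<comment> \<open>From index \<open>i\<close> on the sequence stays in the closed set
    \<open>F i\<close>, hence so does its cluster point.\<close>
  have z: "z \<in> F i" for i
  proof (rule Lim_in_closed_set[OF compact_imp_closed _ G(1,3)])
    show "compact (F i)"
      using F by blast
    have "eventually (\<lambda>n. x n \<in> F i) sequentially"
      using eventually_ge_at_top[of i] by eventually_elim (use x anti in blast)
    with G(2) show "eventually (\<lambda>n. x n \<in> F i) G"
      by (simp add: le_filter_def)
  qed
  have "z extreme_point_of K"
    unfolding extreme_point_of_def
  proof (intro conjI ballI notI)
    show "z \<in> K"
      using z[of 0] FK by blast
    fix u v assume uv: "u \<in> K" "v \<in> K" "z \<in> open_segment u v"
    have face: "f i u = f i z \<and> f i v = f i z \<and> u \<in> M (f i) S \<and> v \<in> M (f i) S"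
      if "z \<in> M (f i) S" "u \<in> S" "v \<in> S" for i S
    proof -
      have "f i u \<le> f i z" "f i v \<le> f i z"
        using that by (auto simp: M_def)
      then have "f i u = f i z" "f i v = f i z"
        using linear_open_segment_le[OF f(1) uv(3)] by blast+
      then show ?thesis
        using that by (simp add: M_def)
    qed
    have "u \<in> F i \<and> v \<in> F i \<and> f i u = f i z \<and> f i v = f i z" for i
    proof (induction i)
      case 0
      then show ?case
        using face[of 0 K] z[of 0] uv by (simp add: F0)
    next
      case (Suc i)
      then show ?case
        using face[of "Suc i" "F i"] z[of "Suc i"] by (simp add: FSuc)
    qed
    then have "u = v"
      using sep uv by metis
    with uv(3) show False
      by simp
  qed
  moreover have "f 0 y \<le> f 0 z" if "y \<in> K" for y
    using z[of 0] that by (auto simp: F0 M_def)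
  ultimately show thesis
    using that by blast
qed

section \<open>Polyhedra with countably many constraints\<close>

lemma feasible_iff: "x \<in> feasible A \<phi> b \<longleftrightarrow> (\<forall>\<alpha>\<in>A. \<phi> \<alpha> x \<le> b \<alpha>)"
  by (simp add: feasible_def halfspace_def)

lemma active_iff: "\<alpha> \<in> active A \<phi> b p \<longleftrightarrow> \<alpha> \<in> A \<and> \<phi> \<alpha> p = b \<alpha>"
  by (simp add: active_def hyperplane_def)

lemma edge_line_iff:
  "z \<in> edge_line A \<phi> b e p k \<longleftrightarrow> (\<forall>\<alpha>\<in>active A \<phi> b p - {e p k}. \<phi> \<alpha> z = b \<alpha>)"
  by (auto simp: edge_line_def hyperplane_def)

lemma edge_ray_iff:
  "z \<in> edge_ray A \<phi> b e p k \<longleftrightarrow>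
    (\<forall>\<alpha>\<in>active A \<phi> b p - {e p k}. \<phi> \<alpha> z = b \<alpha>) \<and> \<phi> (e p k) z \<le> b (e p k)"
  by (simp add: edge_ray_def edge_line_iff halfspace_def)

locale compact_polyhedron =
  fixes A :: "'i set"
    and \<phi> :: "'i \<Rightarrow> 'a::{topological_real_vector, t2_space} \<Rightarrow> real"
    and b :: "'i \<Rightarrow> real"
  assumes linear: "\<And>\<alpha>. \<alpha> \<in> A \<Longrightarrow> linear (\<phi> \<alpha>)"
    and continuous: "\<And>\<alpha>. \<alpha> \<in> A \<Longrightarrow> continuous_on UNIV (\<phi> \<alpha>)"
    and countable: "countable A"
    and compact: "compact (feasible A \<phi> b)"
    and nonempty: "feasible A \<phi> b \<noteq> {}"
begin

abbreviation "P \<equiv> feasible A \<phi> b"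
abbreviation "E \<equiv> extreme_points A \<phi> b"
abbreviation "act \<equiv> active A \<phi> b"

lemma extreme_feasible: "p \<in> E \<Longrightarrow> p \<in> P"
  by (simp add: extreme_points_def extreme_point_of_def)

lemma lin_simps:
  assumes "\<alpha> \<in> A"
  shows "\<phi> \<alpha> (x + y) = \<phi> \<alpha> x + \<phi> \<alpha> y" "\<phi> \<alpha> (x - y) = \<phi> \<alpha> x - \<phi> \<alpha> y"
    "\<phi> \<alpha> (r *\<^sub>R x) = r * \<phi> \<alpha> x" "\<phi> \<alpha> 0 = 0" "\<phi> \<alpha> (- x) = - \<phi> \<alpha> x"
  using linear[OF assms] by (simp_all add: linear_add linear_diff linear_scale linear_0 linear_neg)

text \<open>Following \<open>t\<close> from \<open>p\<close> never leaves \<open>P\<close>, which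
  compactness permits only for \<open>t = 0\<close>.\<close>

lemma no_recession:
  assumes "p \<in> P" "\<And>\<alpha>. \<alpha> \<in> A \<Longrightarrow> \<phi> \<alpha> t \<le> 0"
  shows "t = 0"
proof (rule ray_in_compact_imp_zero[OF compact])
  fix n
  show "p + real n *\<^sub>R t \<in> P"
    unfolding feasible_iff
  proof
    fix \<alpha> assume \<alpha>: "\<alpha> \<in> A"
    have "real n * \<phi> \<alpha> t \<le> 0"
      using assms(2)[OF \<alpha>] by (simp add: mult_nonneg_nonpos)
    with assms(1) \<alpha> show "\<phi> \<alpha> (p + real n *\<^sub>R t) \<le> b \<alpha>"
      by (force simp: feasible_iff lin_simps)
  qed
qed

text \<open>The constraint functionals separate points, because a vector annihilated by all of them
  is a direction of recession.\<close>

lemma extreme_minimizer: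
  fixes c :: "'a \<Rightarrow> real"
  assumes c: "linear c" "continuous_on UNIV c"
  obtains x where "x \<in> E" "is_arg_min c (\<lambda>x. x \<in> P) x"
proof -
  \<comment> \<open>Stage 0 maximizes \<open>- c\<close>. The value \<open>from_nat_into A j\<close>
    can lie outside \<open>A\<close> only if \<open>A\<close> is empty; the zero functional then
    fills the sequence.\<close>
  define f where "f i = (case i of 0 \<Rightarrow> (\<lambda>x. - c x) | Suc j \<Rightarrow>
    (if from_nat_into A j \<in> A then \<phi> (from_nat_into A j) else (\<lambda>x. 0)))" for i
  have "linear (f i)" "continuous_on UNIV (f i)" for i
    using linear continuous c
    by (auto simp: f_def linear_compose_neg linear_zero split: nat.split intro!: continuous_on_minus)
  moreover have "x = y" if eq: "\<And>i. f i x = f i y" for x y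
  proof -
    have "\<phi> \<alpha> x = \<phi> \<alpha> y" if "\<alpha> \<in> A" for \<alpha>
      using eq[of "Suc (to_nat_on A \<alpha>)"] that countable by (simp add: f_def)
    then have "x - y = 0"
      using nonempty no_recession[of _ "x - y"] by (auto simp: lin_simps)
    then show ?thesis
      by simp
  qed
  ultimately obtain z where z: "z extreme_point_of P" "\<And>y. y \<in> P \<Longrightarrow> f 0 y \<le> f 0 z"
    using extreme_point_maximizing[OF compact nonempty, of f] by metis
  then have "z \<in> E" "is_arg_min c (\<lambda>x. x \<in> P) z"
    by (auto simp: extreme_points_def is_arg_min_linorder f_def extreme_point_of_def)
  then show thesis
    using that by blast
qed

end

section \<open>Edges and adjacent extreme points\<close>

text \<open>The extended-real hypotheses (ii) and (iii) enter as real bounds, and the edge norms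
  only through their consequence \<open>adjacent_neq\<close>.\<close>

locale nondegenerate_polyhedron = compact_polyhedron A \<phi> b
  for A :: "'i set"
    and \<phi> :: "'i \<Rightarrow> 'a::{topological_real_vector, t2_space} \<Rightarrow> real"
    and b :: "'i \<Rightarrow> real" +
  fixes e :: "'a \<Rightarrow> nat \<Rightarrow> 'i" and \<rho> :: real
  assumes simple: "\<And>p \<alpha>. p \<in> extreme_points A \<phi> b \<Longrightarrow> \<alpha> \<in> active A \<phi> b p \<Longrightarrow>
      {p} \<subset> (\<Inter>\<alpha>'\<in>active A \<phi> b p - {\<alpha>}. hyperplane \<phi> b \<alpha>')"
    and \<rho>_pos: "0 < \<rho>"
    and slack_ge: "\<And>p \<alpha>. p \<in> extreme_points A \<phi> b \<Longrightarrow> \<alpha> \<in> A - active A \<phi> b p \<Longrightarrow>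
      \<rho> \<le> slack \<phi> b \<alpha> p"
    and flat_bounded: "\<And>p r. p \<in> extreme_points A \<phi> b \<Longrightarrow>
      (\<And>\<alpha>. \<alpha> \<in> active A \<phi> b p \<Longrightarrow> \<phi> \<alpha> r = 0) \<Longrightarrow>
      \<exists>B. \<forall>\<alpha>\<in>A - active A \<phi> b p. \<phi> \<alpha> r \<le> B"
    and enum: "\<And>p. p \<in> extreme_points A \<phi> b \<Longrightarrow> enumeration (active A \<phi> b p) (e p)"
    and compact_sums: "\<And>p x. p \<in> extreme_points A \<phi> b \<Longrightarrow>
      \<exists>C. compact C \<and> {edge_partial_sum A \<phi> b e x p n | n. n \<ge> 1} \<subseteq> C"
    and adjacent_neq: "\<And>p k. p \<in> extreme_points A \<phi> b \<Longrightarrow> k \<in> indices A \<phi> b p \<Longrightarrow>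
      adjacent A \<phi> b e p k \<noteq> p"
begin

abbreviation "idx \<equiv> indices A \<phi> b"
abbreviation "dir \<equiv> edge_direction A \<phi> b e"
abbreviation "stp \<equiv> edge_step A \<phi> b e"
abbreviation "adj \<equiv> adjacent A \<phi> b e"

lemma slack_bound: "p \<in> E \<Longrightarrow> \<alpha> \<in> A \<Longrightarrow> \<alpha> \<notin> act p \<Longrightarrow> \<phi> \<alpha> p + \<rho> \<le> b \<alpha>"
  using slack_ge[of p \<alpha>] by (simp add: slack_def)

lemma bij_enum: "p \<in> E \<Longrightarrow> bij_betw (e p) (idx p) (act p)"
  using enum by (simp add: enumeration_def indices_def)

lemma e_act: "p \<in> E \<Longrightarrow> k \<in> idx p \<Longrightarrow> e p k \<in> act p"
  using bij_betwE[OF bij_enum] by blast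

lemma e_mem: "p \<in> E \<Longrightarrow> k \<in> idx p \<Longrightarrow> e p k \<in> A"
  using e_act by (auto simp: active_iff)

lemma e_eq_iff: "p \<in> E \<Longrightarrow> k \<in> idx p \<Longrightarrow> j \<in> idx p \<Longrightarrow> e p k = e p j \<longleftrightarrow> k = j"
  using bij_betw_imp_inj_on[OF bij_enum] by (auto dest: inj_onD)

lemma act_cases:
  assumes "p \<in> E" "\<alpha> \<in> act p"
  obtains k where "k \<in> idx p" "\<alpha> = e p k"
  using bij_betw_imp_surj_on[OF bij_enum] assms by blast

text \<open>Along \<open>r\<close> and \<open>- r\<close> the inactive constraints grow at a bounded
  rate, while their slacks at \<open>p\<close> are at least \<rho>. For \<open>r \<noteq> 0\<close>
  a short segment around \<open>p\<close> would therefore be feasible, contradicting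
  extremality.\<close>

lemma active_flat_trivial:
  assumes p: "p \<in> E" and r: "\<And>\<alpha>. \<alpha> \<in> act p \<Longrightarrow> \<phi> \<alpha> r = 0"
  shows "r = 0"
proof (rule ccontr)
  assume "r \<noteq> 0"
  have A: "\<alpha> \<in> A" if "\<alpha> \<in> act p" for \<alpha>
    using that by (simp add: active_iff)
  obtain B1 where B1: "\<And>\<alpha>. \<alpha> \<in> A - act p \<Longrightarrow> \<phi> \<alpha> r \<le> B1"
    using flat_bounded[OF p r] by blast
  obtain B2 where B2: "\<And>\<alpha>. \<alpha> \<in> A - act p \<Longrightarrow> \<phi> \<alpha> (- r) \<le> B2"
    using flat_bounded[OF p, of "- r"] r A by (auto simp: lin_simps)
  \<comment> \<open>The 1 keeps \<open>B\<close> positive; a step of size \<open>\<rho> / B\<close>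
    then uses up at most the slack \<rho>.\<close>
  define B where "B = max 1 (max B1 B2)"
  have B: "0 < B" "B1 \<le> B" "B2 \<le> B"
    by (auto simp: B_def)
  define \<epsilon> where "\<epsilon> = \<rho> / B"
  have \<epsilon>: "0 < \<epsilon>" "\<epsilon> * B = \<rho>"
    using B \<rho>_pos by (auto simp: \<epsilon>_def)
  have mem: "p + s *\<^sub>R r \<in> P" if s: "\<bar>s\<bar> = \<epsilon>" for s
    unfolding feasible_iff
  proof
    fix \<alpha> assume \<alpha>: "\<alpha> \<in> A"
    show "\<phi> \<alpha> (p + s *\<^sub>R r) \<le> b \<alpha>"
    proof (cases "\<alpha> \<in> act p")
      case True
      then show ?thesis
        using r \<alpha> by (simp add: lin_simps active_iff)
    next
      case False
      have "\<bar>\<phi> \<alpha> r\<bar> \<le> B"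
        using B1[of \<alpha>] B2[of \<alpha>] \<alpha> False B unfolding lin_simps(5)[OF \<alpha>] by auto
      then have "\<epsilon> * \<bar>\<phi> \<alpha> r\<bar> \<le> \<epsilon> * B"
        using \<epsilon>(1) by (intro mult_left_mono) auto
      then have "\<bar>s * \<phi> \<alpha> r\<bar> \<le> \<rho>"
        using s \<epsilon>(2) by (simp add: abs_mult)
      with slack_bound[OF p \<alpha> False] show ?thesis
        using \<alpha> by (simp add: lin_simps)
    qed
  qed
  have "p + \<epsilon> *\<^sub>R r \<in> P" "p + (- \<epsilon>) *\<^sub>R r \<in> P"
    using mem[of \<epsilon>] mem[of "- \<epsilon>"] \<epsilon>(1) by auto
  moreover have "p \<in> open_segment (p + \<epsilon> *\<^sub>R r) (p + (- \<epsilon>) *\<^sub>R r)"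
    unfolding in_segment
  proof (intro conjI exI[of _ "1 / 2"])
    have "\<epsilon> *\<^sub>R r \<noteq> (- \<epsilon>) *\<^sub>R r"
      using \<epsilon>(1) \<open>r \<noteq> 0\<close> unfolding scaleR_cancel_right by simp
    then show "p + \<epsilon> *\<^sub>R r \<noteq> p + (- \<epsilon>) *\<^sub>R r"
      by simp
    show "p = (1 - 1 / 2) *\<^sub>R (p + \<epsilon> *\<^sub>R r) + (1 / 2) *\<^sub>R (p + (- \<epsilon>) *\<^sub>R r)"
      by (simp add: algebra_simps flip: scaleR_add_left)
  qed simp_all
  ultimately show False
    using p unfolding extreme_points_def extreme_point_of_def by blast
qed

text \<open>Hypothesis \<open>simple\<close> yields a non-zero \<open>w\<close> annihilated by all
  active functionals but the k-th. By \<open>active_flat_trivial\<close> the k-th does not vanish on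
  \<open>w\<close>, and \<open>w\<close> is unique up to a factor, so the edge is a genuine
  ray.\<close>

lemma dir:
  assumes p: "p \<in> E" and k: "k \<in> idx p"
  shows dir_neq: "dir p k \<noteq> 0"
    and dir_zero: "\<And>\<alpha>. \<alpha> \<in> act p \<Longrightarrow> \<alpha> \<noteq> e p k \<Longrightarrow> \<phi> \<alpha> (dir p k) = 0"
    and dir_neg: "\<phi> (e p k) (dir p k) < 0"
    and ray_dir: "edge_ray A \<phi> b e p k = {p + l *\<^sub>R dir p k | l. 0 \<le> l}"
proof -
  let ?\<alpha> = "e p k"
  have A: "\<alpha> \<in> A" "b \<alpha> = \<phi> \<alpha> p" if "\<alpha> \<in> act p" for \<alpha>
    using that by (simp_all add: active_iff)
  note ka = e_act[OF p k] note kA = e_mem[OF p k]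
  obtain z where z: "z \<noteq> p" "\<And>\<alpha>. \<alpha> \<in> act p - {?\<alpha>} \<Longrightarrow> \<phi> \<alpha> z = b \<alpha>"
    using simple[OF p ka] by (auto simp: hyperplane_def)
  define w where "w = z - p"
  have w: "w \<noteq> 0" "\<And>\<alpha>. \<alpha> \<in> act p \<Longrightarrow> \<alpha> \<noteq> ?\<alpha> \<Longrightarrow> \<phi> \<alpha> w = 0"
    using z A by (auto simp: w_def lin_simps(2))
  have wk: "\<phi> ?\<alpha> w \<noteq> 0"
    using active_flat_trivial[OF p, of w] w by metis
  \<comment> \<open>With this normalization the parameter of a point of the ray is its slack in the
    k-th constraint.\<close>
  define t where "t = (- 1 / \<phi> ?\<alpha> w) *\<^sub>R w"
  have t: "t \<noteq> 0" "\<And>\<alpha>. \<alpha> \<in> act p \<Longrightarrow> \<alpha> \<noteq> ?\<alpha> \<Longrightarrow> \<phi> \<alpha> t = 0" "\<phi> ?\<alpha> t = - 1"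
    using w wk A kA by (auto simp: t_def lin_simps)
  have "edge_ray A \<phi> b e p k = {p + l *\<^sub>R t | l. 0 \<le> l}"
  proof (intro set_eqI iffI)
    fix y assume y: "y \<in> edge_ray A \<phi> b e p k"
    define l where "l = - \<phi> ?\<alpha> (y - p)"
    have "y - p - l *\<^sub>R t = 0"
    proof (rule active_flat_trivial[OF p])
      fix \<alpha> assume \<alpha>: "\<alpha> \<in> act p"
      show "\<phi> \<alpha> (y - p - l *\<^sub>R t) = 0"
        using y t A[OF \<alpha>] \<alpha> by (cases "\<alpha> = ?\<alpha>") (auto simp: lin_simps edge_ray_iff l_def)
    qed
    then have "y = p + l *\<^sub>R t"
      by (simp add: algebra_simps)
    moreover have "0 \<le> l"
      using y A(2)[OF ka] kA by (simp add: l_def lin_simps edge_ray_iff)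
    ultimately show "y \<in> {p + l *\<^sub>R t | l. 0 \<le> l}"
      by blast
  next
    fix y assume "y \<in> {p + l *\<^sub>R t | l. 0 \<le> l}"
    then obtain l where l: "0 \<le> l" "y = p + l *\<^sub>R t"
      by blast
    have "\<phi> \<alpha> y = b \<alpha>" if "\<alpha> \<in> act p - {?\<alpha>}" for \<alpha>
      using t(2)[of \<alpha>] A[of \<alpha>] l(2) that by (simp add: lin_simps)
    then show "y \<in> edge_ray A \<phi> b e p k"
      using l t(3) kA A(2)[OF ka] by (simp add: edge_ray_iff lin_simps)
  qed
  with t(1) have "\<exists>t. t \<noteq> 0 \<and> edge_ray A \<phi> b e p k = {p + l *\<^sub>R t | l. 0 \<le> l}"
    by (intro exI[of _ t] conjI)
  then have "dir p k \<noteq> 0 \<and> edge_ray A \<phi> b e p k = {p + l *\<^sub>R dir p k | l. 0 \<le> l}"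
    unfolding edge_direction_def by (rule someI_ex)
  then show *: "dir p k \<noteq> 0" "edge_ray A \<phi> b e p k = {p + l *\<^sub>R dir p k | l. 0 \<le> l}"
    by blast+
  \<comment> \<open>The chosen direction need not be \<open>t\<close>; its values under the active
    functionals are read off from the point with parameter 1.\<close>
  have "p + 1 *\<^sub>R dir p k \<in> edge_ray A \<phi> b e p k"
    unfolding *(2) by (intro CollectI exI[of _ 1]) simp
  then have **: "\<phi> \<alpha> (dir p k) = 0" if "\<alpha> \<in> act p" "\<alpha> \<noteq> ?\<alpha>" for \<alpha>
    using that A by (auto simp: edge_ray_iff lin_simps)
  then show "\<And>\<alpha>. \<alpha> \<in> act p \<Longrightarrow> \<alpha> \<noteq> ?\<alpha> \<Longrightarrow> \<phi> \<alpha> (dir p k) = 0" .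
  have "\<phi> ?\<alpha> (dir p k) \<le> 0"
    using \<open>p + 1 *\<^sub>R dir p k \<in> _\<close> A(2)[OF ka] kA by (auto simp: edge_ray_iff lin_simps)
  moreover have "\<phi> ?\<alpha> (dir p k) \<noteq> 0"
    using active_flat_trivial[OF p, of "dir p k"] *(1) ** by metis
  ultimately show "\<phi> ?\<alpha> (dir p k) < 0"
    by simp
qed

lemma edge_space_iff:
  assumes p: "p \<in> E" and k: "k \<in> idx p"
  shows "y \<in> edge_space A \<phi> b e p k \<longleftrightarrow> (\<forall>\<alpha>\<in>act p - {e p k}. \<phi> \<alpha> y = 0)"
proof -
  have "y \<in> edge_space A \<phi> b e p k \<longleftrightarrow> p + y \<in> edge_line A \<phi> b e p k"
    unfolding edge_space_def by (auto simp: image_iff algebra_simps)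
  then show ?thesis
    by (auto simp: edge_line_iff active_iff lin_simps)
qed

text \<open>An inactive constraint is strict at \<open>p\<close>, so the ray can violate it only
  after crossing its hyperplane; active constraints do not increase along the ray.\<close>

lemma ray_feasible_iff:
  assumes p: "p \<in> E" and k: "k \<in> idx p" and l: "0 \<le> l"
  shows "p + l *\<^sub>R dir p k \<in> P \<longleftrightarrow> (\<forall>\<beta>\<in>A - act p.
    hyperplane \<phi> b \<beta> \<inter> edge_ray A \<phi> b e p k \<noteq> {} \<longrightarrow> p + l *\<^sub>R dir p k \<in> halfspace \<phi> b \<beta>)"
    (is "_ \<longleftrightarrow> ?R")
proof
  assume ?R
  show "p + l *\<^sub>R dir p k \<in> P"
    unfolding feasible_iff
  proof
    fix \<alpha> assume \<alpha>: "\<alpha> \<in> A"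
    show "\<phi> \<alpha> (p + l *\<^sub>R dir p k) \<le> b \<alpha>"
    proof (cases "\<alpha> \<in> act p")
      case True
      then have "\<phi> \<alpha> (dir p k) \<le> 0"
        using dir_zero[OF p k] dir_neg[OF p k] by fastforce
      then have "l * \<phi> \<alpha> (dir p k) \<le> 0"
        using l by (simp add: mult_nonneg_nonpos)
      with True \<alpha> show ?thesis
        by (simp add: active_iff lin_simps)
    next
      case False
      show ?thesis
      proof (rule ccontr)
        assume gt: "\<not> ?thesis"
        with \<open>?R\<close> \<alpha> False have empty: "hyperplane \<phi> b \<alpha> \<inter> edge_ray A \<phi> b e p k = {}"
          by (auto simp: halfspace_def)
        have "\<phi> \<alpha> p < b \<alpha>"
          using slack_bound[OF p \<alpha> False] \<rho>_pos by simp
        with gt \<alpha> have pos: "0 < l * \<phi> \<alpha> (dir p k)"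
          by (simp add: lin_simps)
        then have d: "0 < \<phi> \<alpha> (dir p k)"
          using l by (simp add: zero_less_mult_iff)
        define m where "m = (b \<alpha> - \<phi> \<alpha> p) / \<phi> \<alpha> (dir p k)"
        have "0 \<le> m"
          using d \<open>\<phi> \<alpha> p < b \<alpha>\<close> by (simp add: m_def)
        then have "p + m *\<^sub>R dir p k \<in> edge_ray A \<phi> b e p k"
          unfolding ray_dir[OF p k] by blast
        moreover have "p + m *\<^sub>R dir p k \<in> hyperplane \<phi> b \<alpha>"
          using d \<alpha> by (simp add: hyperplane_def lin_simps m_def)
        ultimately show False
          using empty by blast
      qed
    qed
  qed
qed (auto simp: feasible_iff halfspace_def)

text \<open>As \<open>P\<close> has no direction of recession, some constraint increases along the
  ray and bounds the feasible parameters. Their supremum still satisfies every constraint, so the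
  \<open>GREATEST\<close> in \<open>edge_step\<close> is attained.\<close>

lemma stp:
  assumes p: "p \<in> E" and k: "k \<in> idx p"
  shows stp_nonneg: "0 \<le> stp p k"
    and stp_feasible: "p + stp p k *\<^sub>R dir p k \<in> P"
    and stp_max: "\<And>l. 0 \<le> l \<Longrightarrow> p + l *\<^sub>R dir p k \<in> P \<Longrightarrow> l \<le> stp p k"
proof -
  let ?Q = "\<lambda>l. 0 \<le> l \<and> p + l *\<^sub>R dir p k \<in> P"
  have pP: "p \<in> P"
    using extreme_feasible[OF p] .
  obtain \<alpha> where \<alpha>: "\<alpha> \<in> A" "0 < \<phi> \<alpha> (dir p k)"
    using no_recession[OF pP, of "dir p k"] dir_neq[OF p k] by force
  have bdd: "bdd_above {l. ?Q l}"
  proof (rule bdd_aboveI)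
    fix l assume "l \<in> {l. ?Q l}"
    then have "l * \<phi> \<alpha> (dir p k) \<le> b \<alpha> - \<phi> \<alpha> p"
      using \<alpha> by (auto simp: feasible_iff lin_simps algebra_simps dest!: bspec[of _ _ \<alpha>])
    then show "l \<le> (b \<alpha> - \<phi> \<alpha> p) / \<phi> \<alpha> (dir p k)"
      using \<alpha> by (simp add: field_simps)
  qed
  have ne: "{l. ?Q l} \<noteq> {}"
    using pP by (auto intro: exI[of _ 0])
  define m where "m = Sup {l. ?Q l}"
  have max: "l \<le> m" if "?Q l" for l
    unfolding m_def using bdd that by (intro cSup_upper) auto
  have "0 \<le> m"
    using max[of 0] pP by simp
  moreover have "p + m *\<^sub>R dir p k \<in> P"
    unfolding feasible_iff
  proof
    fix \<beta> assume \<beta>: "\<beta> \<in> A"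
    show "\<phi> \<beta> (p + m *\<^sub>R dir p k) \<le> b \<beta>"
    proof (cases "0 < \<phi> \<beta> (dir p k)")
      case True
      have "m \<le> (b \<beta> - \<phi> \<beta> p) / \<phi> \<beta> (dir p k)"
        unfolding m_def
      proof (rule cSup_least[OF ne])
        fix l assume "l \<in> {l. ?Q l}"
        then have "l * \<phi> \<beta> (dir p k) \<le> b \<beta> - \<phi> \<beta> p"
          using \<beta> by (auto simp: feasible_iff lin_simps algebra_simps dest!: bspec[of _ _ \<beta>])
        then show "l \<le> (b \<beta> - \<phi> \<beta> p) / \<phi> \<beta> (dir p k)"
          using True by (simp add: field_simps)
      qed
      then show ?thesis
        using True \<beta> by (simp add: lin_simps field_simps)
    next
      case False
      then have "m * \<phi> \<beta> (dir p k) \<le> 0"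
        using \<open>0 \<le> m\<close> by (simp add: mult_nonneg_nonpos)
      moreover have "\<phi> \<beta> p \<le> b \<beta>"
        using pP \<beta> by (simp add: feasible_iff)
      ultimately show ?thesis
        using \<beta> by (simp add: lin_simps)
    qed
  qed
  moreover have "stp p k = Greatest ?Q"
    unfolding edge_step_def
    by (intro arg_cong[of _ _ Greatest] ext conj_cong refl sym[OF ray_feasible_iff[OF p k]])
  ultimately have "?Q m" "stp p k = m"
    using Greatest_equality[of ?Q m] max by simp_all
  with max show "0 \<le> stp p k" "p + stp p k *\<^sub>R dir p k \<in> P"
    "\<And>l. 0 \<le> l \<Longrightarrow> p + l *\<^sub>R dir p k \<in> P \<Longrightarrow> l \<le> stp p k"
    by auto
qed

section \<open>Extremality of adjacent points\<close>

lemma adj_diff: "adj p k - p = stp p k *\<^sub>R dir p k"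
  by (simp add: adjacent_def)

lemma stp_pos:
  assumes "p \<in> E" "k \<in> idx p"
  shows "0 < stp p k"
  using adjacent_neq[OF assms] stp_nonneg[OF assms] adj_diff[of p k] by (cases "stp p k = 0") auto

text \<open>An adjacent point is an end point of the face \<open>P \<inter> \<ell>\<^sub>k(p)\<close>, which is a segment.\<close>

lemma adj_extreme:
  assumes p: "p \<in> E" and k: "k \<in> idx p"
  shows "adj p k \<in> E"
  unfolding extreme_points_def extreme_point_of_def mem_Collect_eq
proof (intro conjI ballI notI)
  let ?t = "dir p k" and ?q = "adj p k"
  show "?q \<in> P"
    using stp_feasible[OF p k] by (simp add: adjacent_def)
  have seg: "\<exists>l. w = p + l *\<^sub>R ?t \<and> l \<le> stp p k"
    if w: "w \<in> P" "\<And>\<alpha>. \<alpha> \<in> act p \<Longrightarrow> \<alpha> \<noteq> e p k \<Longrightarrow> \<phi> \<alpha> w = b \<alpha>" for w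
  proof -
    have "w \<in> edge_ray A \<phi> b e p k"
      using w e_mem[OF p k] by (auto simp: edge_ray_iff feasible_iff)
    then obtain l where "0 \<le> l" "w = p + l *\<^sub>R ?t"
      unfolding ray_dir[OF p k] by blast
    then show ?thesis
      using stp_max[OF p k, of l] w(1) by blast
  qed
  fix u v assume uv: "u \<in> P" "v \<in> P" "?q \<in> open_segment u v"
  have q: "\<phi> \<alpha> ?q = b \<alpha>" if "\<alpha> \<in> act p" "\<alpha> \<noteq> e p k" for \<alpha>
    using dir_zero[OF p k that] that(1) by (simp add: adjacent_def active_iff lin_simps)
  have face: "\<phi> \<alpha> u = b \<alpha> \<and> \<phi> \<alpha> v = b \<alpha>" if \<alpha>: "\<alpha> \<in> act p" "\<alpha> \<noteq> e p k" for \<alpha>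
  proof -
    have "\<alpha> \<in> A"
      using \<alpha> by (simp add: active_iff)
    then show ?thesis
      using linear_open_segment_le[OF linear uv(3), of \<alpha>] uv(1,2) q[OF \<alpha>]
      by (simp add: feasible_iff)
  qed
  obtain l where l: "u = p + l *\<^sub>R ?t" "l \<le> stp p k"
    using seg[OF uv(1)] face by blast
  obtain m where m: "v = p + m *\<^sub>R ?t" "m \<le> stp p k"
    using seg[OF uv(2)] face by blast
  let ?f = "\<phi> (e p k)"
  note kA = e_mem[OF p k]
  \<comment> \<open>The k-th functional decreases along the ray, so on the feasible segment it is
    smallest at the adjacent point; it must then take this value at \<open>u\<close> and
    \<open>v\<close> too.\<close>
  have le: "?f ?q \<le> ?f (p + l *\<^sub>R ?t)" if "l \<le> stp p k" for l
    using dir_neg[OF p k] kA that by (simp add: adjacent_def lin_simps mult_right_mono_neg)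
  have "linear (\<lambda>x. - ?f x)"
    using linear[OF kA] by (rule linear_compose_neg)
  then have "?f u = ?f ?q" "?f v = ?f ?q"
    using linear_open_segment_le[of "\<lambda>x. - ?f x", OF _ uv(3)] le l m by simp_all
  then have "?f u = ?f v"
    by simp
  then have "l * ?f ?t = m * ?f ?t"
    using l m kA by (simp add: lin_simps)
  then have "l = m"
    using dir_neg[OF p k] by simp
  with l m have "u = v"
    by simp
  with uv(3) show False
    by simp
qed

text \<open>A positive step makes the k-th constraint inactive at the adjacent point, where the
  uniform slack bound applies because that point is again extreme.\<close>

lemma e_not_active_adj:
  assumes p: "p \<in> E" and k: "k \<in> idx p"
  shows "\<phi> (e p k) (adj p k - p) \<le> - \<rho>"
proof -
  note kA = e_mem[OF p k]
  have "\<phi> (e p k) (adj p k - p) < 0"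
    using stp_pos[OF p k] dir_neg[OF p k] kA by (simp add: adj_diff lin_simps mult_pos_neg)
  moreover have "\<phi> (e p k) p = b (e p k)"
    using e_act[OF p k] by (simp add: active_iff)
  ultimately have "e p k \<notin> act (adj p k)" "\<phi> (e p k) p = b (e p k)"
    using kA by (auto simp: active_iff lin_simps)
  then show ?thesis
    using slack_bound[OF adj_extreme[OF p k] kA] kA by (simp add: lin_simps)
qed

section \<open>Expansion along the edges at an extreme point\<close>

lemma edge_component_eq:
  assumes p: "p \<in> E" and k: "k \<in> idx p"
  shows "edge_component A \<phi> b e x p k =
    (\<phi> (e p k) (x - p) / \<phi> (e p k) (adj p k - p)) *\<^sub>R (adj p k - p)" (is "_ = ?y")
  unfolding edge_component_def
proof (rule the_equality)
  note kA = e_mem[OF p k]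
  have ne: "\<phi> (e p k) (adj p k - p) \<noteq> 0"
    using e_not_active_adj[OF p k] \<rho>_pos by simp
  have z: "\<phi> \<alpha> (adj p k - p) = 0" if "\<alpha> \<in> act p" "\<alpha> \<noteq> e p k" for \<alpha>
    using dir_zero[OF p k that] that by (simp add: adj_diff active_iff lin_simps)
  have y: "\<phi> \<alpha> ?y = 0" if "\<alpha> \<in> act p" "\<alpha> \<noteq> e p k" for \<alpha>
    using z[OF that] that by (simp add: active_iff lin_simps(3))
  have yk: "\<phi> (e p k) ?y = \<phi> (e p k) (x - p)"
    using ne by (simp add: lin_simps(3)[OF kA])
  from y yk show "?y \<in> edge_space A \<phi> b e p k \<and> \<phi> (e p k) ?y = \<phi> (e p k) (x - p)"
    by (simp add: edge_space_iff[OF p k])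
  fix y' assume y': "y' \<in> edge_space A \<phi> b e p k \<and> \<phi> (e p k) y' = \<phi> (e p k) (x - p)"
  \<comment> \<open>Two candidates agree under every functional active at \<open>p\<close>.\<close>
  have "y' - ?y = 0"
  proof (rule active_flat_trivial[OF p])
    fix \<alpha> assume "\<alpha> \<in> act p"
    then show "\<phi> \<alpha> (y' - ?y) = 0"
      using y' y yk by (cases "\<alpha> = e p k") (auto simp: edge_space_iff[OF p k] active_iff lin_simps(2))
  qed
  then show "y' = ?y"
    by simp
qed

text \<open>Every cluster point of the partial sums \<open>x\<^sup>n(p)\<close> agrees with \<open>x - p\<close> under all
  functionals active at \<open>p\<close>, hence equals \<open>x - p\<close>.\<close>

lemma cost_diff_ge:
  fixes c :: "'a \<Rightarrow> real"
  assumes p: "p \<in> E" and c: "linear c" "continuous_on UNIV c"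
    and sums: "\<And>n. L \<le> (\<Sum>k\<in>{1..n} \<inter> idx p.
      \<phi> (e p k) (x - p) / \<phi> (e p k) (adj p k - p) * c (adj p k - p))"
  shows "L \<le> c x - c p"
proof -
  \<comment> \<open>Shifted by one, since \<open>compact_sums\<close> covers only
    \<open>n \<ge> 1\<close>.\<close>
  let ?S = "\<lambda>n. edge_partial_sum A \<phi> b e x p (Suc n)"
  let ?\<mu> = "\<lambda>k. \<phi> (e p k) (x - p) / \<phi> (e p k) (adj p k - p)"
  have S: "edge_partial_sum A \<phi> b e x p n = (\<Sum>k\<in>{1..n} \<inter> idx p. ?\<mu> k *\<^sub>R (adj p k - p))" for n
    unfolding edge_partial_sum_def using edge_component_eq[OF p] by (intro sum.cong) auto
  obtain C where C: "compact C" "{edge_partial_sum A \<phi> b e x p n | n. n \<ge> 1} \<subseteq> C"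
    using compact_sums[OF p] by blast
  have "?S n \<in> C" for n
    using C(2) by force
  then obtain y G where G: "G \<noteq> bot" "G \<le> sequentially" "(?S \<longlongrightarrow> y) G"
    by (rule compact_cluster_filter[OF C(1)])
  have lim: "((\<lambda>n. f (?S n)) \<longlongrightarrow> f y) G" if "continuous_on UNIV f" for f :: "'a \<Rightarrow> real"
    using continuous_on_tendsto_compose[OF that G(3)] by simp
  have "y - (x - p) = 0"
  proof (rule active_flat_trivial[OF p])
    fix \<alpha> assume "\<alpha> \<in> act p"
    then obtain k where k: "k \<in> idx p" "\<alpha> = e p k"
      using act_cases[OF p] by blast
    note kA = e_mem[OF p k(1)]
    \<comment> \<open>The k-th active functional vanishes on all other edges, so from the k-th term
      on it no longer distinguishes the partial sum from \<open>x - p\<close>.\<close>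
    have other: "\<phi> (e p k) (adj p j - p) = 0" if "j \<in> idx p" "j \<noteq> k" for j
      using dir_zero[OF p that(1) e_act[OF p k(1)]] e_eq_iff[OF p k(1) that(1)] that(2) kA
      by (simp add: adj_diff lin_simps)
    have k1: "k \<ge> 1"
      using k(1) by (auto simp: indices_def positions_def split: if_splits)
    have ne: "\<phi> (e p k) (adj p k - p) \<noteq> 0"
      using e_not_active_adj[OF p k(1)] \<rho>_pos by simp
    have eq: "\<phi> (e p k) (?S n) = \<phi> (e p k) (x - p)" if "k \<le> n" for n
    proof -
      have "\<phi> (e p k) (?S n) = (\<Sum>j\<in>{1..Suc n} \<inter> idx p. ?\<mu> j * \<phi> (e p k) (adj p j - p))"
        unfolding S linear_sum[OF linear[OF kA]] by (simp only: lin_simps(3)[OF kA])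
      also have "\<dots> = (\<Sum>j\<in>{k}. ?\<mu> j * \<phi> (e p k) (adj p j - p))"
        using k(1) k1 that other by (intro sum.mono_neutral_right) auto
      finally show ?thesis
        using ne by simp
    qed
    have "eventually (\<lambda>n. \<phi> (e p k) (?S n) = \<phi> (e p k) (x - p)) sequentially"
      using eventually_ge_at_top[of k] by eventually_elim (rule eq)
    then have "eventually (\<lambda>n. \<phi> (e p k) (?S n) = \<phi> (e p k) (x - p)) G"
      using G(2) by (simp add: le_filter_def)
    then have "((\<lambda>n. \<phi> (e p k) (?S n)) \<longlongrightarrow> \<phi> (e p k) (x - p)) G"
      by (rule tendsto_eventually)
    then have "\<phi> (e p k) y = \<phi> (e p k) (x - p)"
      using tendsto_unique[OF G(1) lim[OF continuous[OF kA]]] by blast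
    then show "\<phi> \<alpha> (y - (x - p)) = 0"
      using k(2) by (simp add: lin_simps(2)[OF kA])
  qed
  then have "((\<lambda>n. c (?S n)) \<longlongrightarrow> c (x - p)) G"
    using lim[OF c(2)] by simp
  \<comment> \<open>A lower bound for all partial sums passes to the cluster point; the series
    itself need not converge.\<close>
  moreover have "L \<le> c (?S n)" for n
    unfolding S linear_sum[OF c(1)] using sums[of "Suc n"] by (simp add: linear_scale[OF c(1)])
  ultimately have "L \<le> c (x - p)"
    by (intro tendsto_lowerbound[OF _ _ G(1)]) auto
  then show ?thesis
    using c(1) by (simp add: linear_diff)
qed

section \<open>Optimality test and convergence of descending sequences\<close>

lemma coefficient_nonneg:
  assumes "p \<in> E" "k \<in> idx p" "x \<in> P"
  shows "0 \<le> \<phi> (e p k) (x - p) / \<phi> (e p k) (adj p k - p)"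
proof (rule divide_nonpos_nonpos)
  show "\<phi> (e p k) (x - p) \<le> 0"
    using assms e_act[of p k] by (auto simp: active_iff feasible_iff lin_simps)
  show "\<phi> (e p k) (adj p k - p) \<le> 0"
    using e_not_active_adj[OF assms(1,2)] \<rho>_pos by simp
qed

text \<open>Non-negative coefficients and edge costs make every partial sum non-negative.\<close>

lemma optimal_if_no_descent:
  fixes c :: "'a \<Rightarrow> real"
  assumes p: "p \<in> E" and c: "linear c" "continuous_on UNIV c"
    and nonneg: "\<And>k. k \<in> idx p \<Longrightarrow> 0 \<le> c (adj p k - p)"
  shows "is_arg_min c (\<lambda>x. x \<in> P) p"
  unfolding is_arg_min_linorder
proof (intro conjI allI impI)
  show "p \<in> P"
    using extreme_feasible[OF p] .
  fix x assume x: "x \<in> P"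
  have "0 \<le> c x - c p"
    using coefficient_nonneg[OF p _ x] nonneg
    by (intro cost_diff_ge[OF p c] sum_nonneg mult_nonneg_nonneg) auto
  then show "c p \<le> c x"
    by simp
qed

text \<open>The hypothesis on \<open>\<kappa>\<close> says that no edge at \<open>s n\<close> descends by more than \<open>\<kappa>\<close> times the
  actual step; as the steps tend to \<open>0\<close>, each single term of the negative part of the edge series
  does too, and the tails are uniformly small.\<close>

lemma descent_converges:
  fixes c :: "'a \<Rightarrow> real"
  assumes c: "linear c" "continuous_on UNIV c"
    and x: "x \<in> E" "is_arg_min c (\<lambda>x. x \<in> P) x"
    and M: "\<And>p \<alpha>. p \<in> E \<Longrightarrow> \<alpha> \<in> A \<Longrightarrow> \<bar>\<phi> \<alpha> p\<bar> \<le> M"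
    and tails: "uniformly_convergent_on E (\<lambda>n p. \<Sum>k\<in>{1..n} \<inter> idx p. \<bar>c (adj p k - p)\<bar>)"
    and s: "\<And>n. s n \<in> E" "\<And>n. c (s (Suc n)) \<le> c (s n)"
    and \<kappa>: "\<And>n k. k \<in> idx (s n) \<Longrightarrow> \<kappa> * (c (s (Suc n)) - c (s n)) \<le> c (adj (s n) k - s n)"
      "0 \<le> \<kappa>"
  shows "(\<lambda>n. c (s n)) \<longlonglongrightarrow> c x"
proof (rule LIMSEQ_I)
  fix r :: real assume r: "0 < r"
  have opt: "c x \<le> c (s n)" for n
    using x(2) extreme_feasible[OF s(1)] by (simp add: is_arg_min_linorder)
  have xP: "x \<in> P"
    using extreme_feasible[OF x(1)] .
  \<comment> \<open>Bounds the coefficients: numerators have size at most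
    \<open>2 * \<bar>M\<bar>\<close>, denominators at least \<rho>. The summand 1 keeps
    \<open>B\<close> positive.\<close>
  define B where "B = 2 * (\<bar>M\<bar> + 1) / \<rho>"
  have B: "0 < B"
    using \<rho>_pos by (simp add: B_def)
  define \<eta> where "\<eta> = r / (2 * B)"
  have \<eta>: "0 < \<eta>" "B * \<eta> = r / 2"
    using B r by (auto simp: \<eta>_def)
  \<comment> \<open>Beyond \<open>K\<close>, which does not depend on \<open>p\<close>, the absolute
    edge costs sum to less than \<eta>.\<close>
  obtain K where K: "\<And>p m. p \<in> E \<Longrightarrow> m \<ge> K \<Longrightarrow>
      dist (\<Sum>k\<in>{1..m} \<inter> idx p. \<bar>c (adj p k - p)\<bar>) (\<Sum>k\<in>{1..K} \<inter> idx p. \<bar>c (adj p k - p)\<bar>) < \<eta>"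
    using uniformly_convergent_Cauchy[OF tails] \<eta>(1) unfolding uniformly_Cauchy_on_def
    by (meson order_refl)
  define \<epsilon> where "\<epsilon> n = \<kappa> * (c (s n) - c (s (Suc n)))" for n
  have \<epsilon>_nonneg: "0 \<le> \<epsilon> n" for n
    using s(2)[of n] \<kappa>(2) by (simp add: \<epsilon>_def)
  have bound: "c (s n) - c x \<le> B * (real K * \<epsilon> n + \<eta>)" for n
  proof -
    let ?p = "s n"
    let ?d = "\<lambda>k. c (adj ?p k - ?p)"
    let ?\<mu> = "\<lambda>k. \<phi> (e ?p k) (x - ?p) / \<phi> (e ?p k) (adj ?p k - ?p)"
    \<comment> \<open>Bounds the negative part of each edge cost: by \<open>\<epsilon> n\<close> for
      the first \<open>K\<close> indices, by the absolute cost in the tail.\<close>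
    define h where "h k = (if k \<le> K then \<epsilon> n else \<bar>?d k\<bar>)" for k
    have h: "0 \<le> h k" for k
      using \<epsilon>_nonneg by (simp add: h_def)
    have \<mu>: "0 \<le> ?\<mu> k" "?\<mu> k \<le> B" if k: "k \<in> idx ?p" for k
    proof -
      note kA = e_mem[OF s(1) k]
      show "0 \<le> ?\<mu> k"
        using coefficient_nonneg[OF s(1) k xP] .
      have "\<bar>\<phi> (e ?p k) (x - ?p)\<bar> \<le> 2 * (\<bar>M\<bar> + 1)"
        using M[OF x(1) kA] M[OF s(1)[of n] kA] by (simp add: lin_simps[OF kA])
      moreover have "\<rho> \<le> \<bar>\<phi> (e ?p k) (adj ?p k - ?p)\<bar>"
        using e_not_active_adj[OF s(1) k] by simp
      ultimately have "\<bar>?\<mu> k\<bar> \<le> B"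
        unfolding B_def abs_divide using \<rho>_pos by (intro frac_le) auto
      then show "?\<mu> k \<le> B"
        by (rule order_trans[OF abs_ge_self])
    qed
    have term_ge: "- (B * h k) \<le> ?\<mu> k * ?d k" if k: "k \<in> idx ?p" for k
    proof -
      have "- h k \<le> ?d k"
        using \<kappa>(1)[OF k] by (auto simp: h_def \<epsilon>_def algebra_simps)
      then have "?\<mu> k * - h k \<le> ?\<mu> k * ?d k"
        using \<mu>(1)[OF k] by (rule mult_left_mono)
      moreover have "?\<mu> k * h k \<le> B * h k"
        using \<mu>(2)[OF k] h by (rule mult_right_mono)
      ultimately show ?thesis
        by simp
    qed
    have h_sum: "(\<Sum>k\<in>{1..m} \<inter> idx ?p. h k) \<le> real K * \<epsilon> n + \<eta>" for m
    proof -
      \<comment> \<open>Enlarging the range can only increase the sum and lets it be split at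
        \<open>K\<close>.\<close>
      define m' where "m' = max m K"
      have "(\<Sum>k\<in>{1..m} \<inter> idx ?p. h k) \<le> (\<Sum>k\<in>{1..m'} \<inter> idx ?p. h k)"
        using h by (intro sum_mono2) (auto simp: m'_def)
      also have "\<dots> = (\<Sum>k\<in>{1..K} \<inter> idx ?p. h k) + (\<Sum>k\<in>{K<..m'} \<inter> idx ?p. h k)"
        by (subst sum.union_disjoint[symmetric]) (auto simp: m'_def intro!: sum.cong)
      also have "(\<Sum>k\<in>{1..K} \<inter> idx ?p. h k) = real (card ({1..K} \<inter> idx ?p)) * \<epsilon> n"
        by (simp add: h_def)
      also have "\<dots> \<le> real K * \<epsilon> n"
        using card_mono[of "{1..K}" "{1..K} \<inter> idx ?p"] \<epsilon>_nonneg by (intro mult_right_mono) auto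
      also have "(\<Sum>k\<in>{K<..m'} \<inter> idx ?p. h k) = (\<Sum>k\<in>{K<..m'} \<inter> idx ?p. \<bar>?d k\<bar>)"
        by (intro sum.cong) (auto simp: h_def)
      also have "\<dots> = (\<Sum>k\<in>{1..m'} \<inter> idx ?p. \<bar>?d k\<bar>) - (\<Sum>k\<in>{1..K} \<inter> idx ?p. \<bar>?d k\<bar>)"
        by (subst eq_diff_eq, subst sum.union_disjoint[symmetric])
          (auto simp: m'_def intro!: sum.cong)
      also have "\<dots> \<le> \<eta>"
        using K[OF s(1)[of n], of m'] by (simp add: dist_real_def m'_def)
      finally show ?thesis
        by simp
    qed
    have "- (B * (real K * \<epsilon> n + \<eta>)) \<le> c x - c ?p"
    proof (rule cost_diff_ge[OF s(1) c])
      fix m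
      have "- (B * (real K * \<epsilon> n + \<eta>)) \<le> - (B * (\<Sum>k\<in>{1..m} \<inter> idx ?p. h k))"
        using h_sum B by (simp add: mult_left_mono)
      also have "\<dots> = (\<Sum>k\<in>{1..m} \<inter> idx ?p. - (B * h k))"
        by (simp add: sum_negf sum_distrib_left)
      also have "\<dots> \<le> (\<Sum>k\<in>{1..m} \<inter> idx ?p. ?\<mu> k * ?d k)"
        using term_ge by (intro sum_mono) auto
      finally show "- (B * (real K * \<epsilon> n + \<eta>)) \<le> (\<Sum>k\<in>{1..m} \<inter> idx ?p. ?\<mu> k * ?d k)" .
    qed
    then show ?thesis
      by simp
  qed
  have "decseq (\<lambda>n. c (s n))"
    using s(2) by (rule decseq_SucI)
  then obtain v where v: "(\<lambda>n. c (s n)) \<longlonglongrightarrow> v"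
    using decseq_convergent opt by blast
  \<comment> \<open>Consecutive costs have the same limit, so \<epsilon> tends to 0.\<close>
  then have "\<epsilon> \<longlonglongrightarrow> \<kappa> * (v - v)"
    unfolding \<epsilon>_def by (intro tendsto_intros LIMSEQ_Suc[OF v])
  then have "(\<lambda>n. B * (real K * \<epsilon> n + \<eta>)) \<longlonglongrightarrow> B * (real K * (\<kappa> * (v - v)) + \<eta>)"
    by (intro tendsto_intros)
  then have "(\<lambda>n. B * (real K * \<epsilon> n + \<eta>)) \<longlonglongrightarrow> r / 2"
    using \<eta>(2) by simp
  then have "eventually (\<lambda>n. B * (real K * \<epsilon> n + \<eta>) < r) sequentially"
    by (rule order_tendstoD(2)) (use r in simp)
  then have "eventually (\<lambda>n. norm (c (s n) - c x) < r) sequentially"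
  proof eventually_elim
    case (elim n)
    with bound[of n] opt[of n] show ?case
      by simp
  qed
  then show "\<exists>no. \<forall>n\<ge>no. norm (c (s n) - c x) < r"
    by (simp add: eventually_sequentially)
qed

end

section \<open>Convergence of the simplex algorithm\<close>

text \<open>A real strictly between 0 and the infimum exists even if the infimum is \<infinity>, as
  over empty index sets.\<close>

lemma INF_INF_pos_bound:
  assumes "0 < (INF x\<in>S. INF y\<in>T x. ereal (f x y))"
  obtains \<delta> where "0 < \<delta>" "\<And>x y. x \<in> S \<Longrightarrow> y \<in> T x \<Longrightarrow> \<delta> \<le> f x y"
proof -
  obtain \<delta> where \<delta>: "0 < ereal \<delta>" "ereal \<delta> < (INF x\<in>S. INF y\<in>T x. ereal (f x y))"
    using ereal_dense2[OF assms] by blast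
  have "\<delta> \<le> f x y" if "x \<in> S" "y \<in> T x" for x y
    using less_INF_D[OF less_INF_D[OF \<delta>(2) that(1)] that(2)] by simp
  then show thesis
    using that \<delta>(1) by simp
qed

lemma SUP_finite_bound:
  assumes "(SUP y\<in>T. ereal (f y)) < \<infinity>"
  obtains D where "\<And>y. y \<in> T \<Longrightarrow> f y \<le> D"
proof -
  obtain D where D: "(SUP y\<in>T. ereal (f y)) < ereal D"
    using ereal_dense2[OF assms] by blast
  have "f y \<le> D" if "y \<in> T" for y
    using SUP_lessD[OF D that] by simp
  then show thesis
    using that by blast
qed

lemma SUP_SUP_finite_bound:
  assumes "(SUP x\<in>S. SUP y\<in>T x. ereal (f x y)) < \<infinity>"
  obtains D where "\<And>x y. x \<in> S \<Longrightarrow> y \<in> T x \<Longrightarrow> f x y \<le> D"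
proof -
  obtain D where D: "(SUP x\<in>S. SUP y\<in>T x. ereal (f x y)) < ereal D"
    using ereal_dense2[OF assms] by blast
  have "f x y \<le> D" if "x \<in> S" "y \<in> T x" for x y
    using SUP_lessD[OF SUP_lessD[OF D that(1)] that(2)] by simp
  then show thesis
    using that by blast
qed

theorem theorem4:
  fixes A :: "'i set"
    and \<phi> :: "'i \<Rightarrow> 'a::locally_convex_t2_space \<Rightarrow> real"
    and b :: "'i \<Rightarrow> real"
    and e :: "'a \<Rightarrow> nat \<Rightarrow> 'i"
    and N :: "'a \<Rightarrow> nat \<Rightarrow> 'a \<Rightarrow> real"
    and c :: "'a \<Rightarrow> real"
  assumes functionals:
      "\<And>\<alpha>. \<alpha> \<in> A \<Longrightarrow> linear (\<phi> \<alpha>) \<and> continuous_on UNIV (\<phi> \<alpha>) \<and> \<phi> \<alpha> \<noteq> (\<lambda>x. 0)"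
    and not_singleton: "\<not> is_singleton (feasible A \<phi> b)"
    and cost: "linear c" "continuous_on UNIV c"
    and i: "feasible A \<phi> b \<noteq> {}" "compact (feasible A \<phi> b)"
    and ii:
      "\<And>p \<alpha>. p \<in> extreme_points A \<phi> b \<Longrightarrow> \<alpha> \<in> active A \<phi> b p \<Longrightarrow>
        {p} \<subset> (\<Inter>\<alpha>'\<in>active A \<phi> b p - {\<alpha>}. hyperplane \<phi> b \<alpha>')"
      "(INF p\<in>extreme_points A \<phi> b. INF \<alpha>\<in>A - active A \<phi> b p. ereal (slack \<phi> b \<alpha> p)) > 0"
    and iii:
      "\<And>p r. p \<in> extreme_points A \<phi> b \<Longrightarrow> r \<in> (\<lambda>z. z - p) ` active_flat A \<phi> b p \<Longrightarrow>
        (SUP \<alpha>\<in>A - active A \<phi> b p. ereal (\<phi> \<alpha> r)) < \<infinity>"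
    and iv: "countable A"
    and enum: "\<And>p. p \<in> extreme_points A \<phi> b \<Longrightarrow> enumeration (active A \<phi> b p) (e p)"
    and norms:
      "\<And>p k. p \<in> extreme_points A \<phi> b \<Longrightarrow> k \<in> indices A \<phi> b p \<Longrightarrow>
        norm_on (edge_space A \<phi> b e p k) (N p k)"
    and v:
      "\<And>p x. p \<in> extreme_points A \<phi> b \<Longrightarrow>
        \<exists>C. compact C \<and> {edge_partial_sum A \<phi> b e x p n | n. n \<ge> 1} \<subseteq> C"
    and vi:
      "(INF p\<in>extreme_points A \<phi> b. INF k\<in>indices A \<phi> b p. ereal (edge_length A \<phi> b e N p k)) > 0"
      "(SUP p\<in>extreme_points A \<phi> b. SUP k\<in>indices A \<phi> b p. ereal (edge_length A \<phi> b e N p k)) < \<infinity>"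
    and vii:
      "\<And>p. p \<in> extreme_points A \<phi> b \<Longrightarrow>
        \<exists>k\<in>indices A \<phi> b p. ereal (cost_rate A \<phi> b e N c p k) = best_rate A \<phi> b e N c p"
    and viii: "(SUP p\<in>extreme_points A \<phi> b. SUP \<alpha>\<in>A. ereal \<bar>\<phi> \<alpha> p\<bar>) < \<infinity>"
    and ix:
      "uniformly_convergent_on (extreme_points A \<phi> b)
        (\<lambda>n p. \<Sum>k\<in>{1..n} \<inter> indices A \<phi> b p. \<bar>c (adjacent A \<phi> b e p k - p)\<bar>)"
  shows
    "\<exists>x_opt. is_arg_min c (\<lambda>x. x \<in> feasible A \<phi> b) x_opt \<and>
      (\<forall>s L. simplex_run A \<phi> b e N c s L \<longrightarrow>
        (\<forall>n. enat n \<le> L \<longrightarrow> s n \<in> extreme_points A \<phi> b) \<and>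
        ((\<exists>m. L = enat m \<and> best_rate A \<phi> b e N c (s m) \<ge> 0 \<and>
            is_arg_min c (\<lambda>x. x \<in> feasible A \<phi> b) (s m)) \<or>
         (L = \<infinity> \<and> (\<lambda>n. c (s n)) \<longlonglongrightarrow> c x_opt)))"
proof -
  obtain \<rho> where \<rho>: "0 < \<rho>"
    "\<And>p \<alpha>. p \<in> extreme_points A \<phi> b \<Longrightarrow> \<alpha> \<in> A - active A \<phi> b p \<Longrightarrow> \<rho> \<le> slack \<phi> b \<alpha> p"
    using ii(2) by (rule INF_INF_pos_bound) blast
  obtain \<delta> where \<delta>: "0 < \<delta>"
    "\<And>p k. p \<in> extreme_points A \<phi> b \<Longrightarrow> k \<in> indices A \<phi> b p \<Longrightarrow> \<delta> \<le> edge_length A \<phi> b e N p k"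
    using vi(1) by (rule INF_INF_pos_bound) blast
  obtain D where D:
    "\<And>p k. p \<in> extreme_points A \<phi> b \<Longrightarrow> k \<in> indices A \<phi> b p \<Longrightarrow> edge_length A \<phi> b e N p k \<le> D"
    using vi(2) by (rule SUP_SUP_finite_bound) blast
  obtain M where M: "\<And>p \<alpha>. p \<in> extreme_points A \<phi> b \<Longrightarrow> \<alpha> \<in> A \<Longrightarrow> \<bar>\<phi> \<alpha> p\<bar> \<le> M"
    using viii by (rule SUP_SUP_finite_bound) blast
  interpret nondegenerate_polyhedron A \<phi> b e \<rho>
  proof (intro nondegenerate_polyhedron.intro compact_polyhedron.intro
      nondegenerate_polyhedron_axioms.intro)
    fix p r
    assume p: "p \<in> extreme_points A \<phi> b" and r: "\<And>\<alpha>. \<alpha> \<in> active A \<phi> b p \<Longrightarrow> \<phi> \<alpha> r = 0"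
    have "\<phi> \<alpha> (p + r) = b \<alpha>" if "\<alpha> \<in> active A \<phi> b p" for \<alpha>
      using r[OF that] that functionals[of \<alpha>] by (simp add: active_iff linear_add)
    then have "p + r \<in> active_flat A \<phi> b p"
      by (simp add: active_flat_def hyperplane_def)
    then have "r \<in> (\<lambda>z. z - p) ` active_flat A \<phi> b p"
      by (rule image_eqI[rotated]) simp
    then show "\<exists>B. \<forall>\<alpha>\<in>A - active A \<phi> b p. \<phi> \<alpha> r \<le> B"
      using SUP_finite_bound[OF iii[OF p]] by metis
  next
    fix p k
    assume p: "p \<in> extreme_points A \<phi> b" and k: "k \<in> indices A \<phi> b p"
    \<comment> \<open>A degenerate edge would have length 0, against the bound \<delta> from
      \<open>vi\<close>.\<close>
    show "adjacent A \<phi> b e p k \<noteq> p"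
    proof
      assume "adjacent A \<phi> b e p k = p"
      then have "edge_length A \<phi> b e N p k = N p k 0"
        by (simp add: edge_length_def)
      moreover have "p \<in> edge_line A \<phi> b e p k"
        by (simp add: edge_line_iff active_iff)
      then have "0 \<in> edge_space A \<phi> b e p k"
        unfolding edge_space_def by (rule image_eqI[rotated]) simp
      then have "N p k 0 = 0"
        using norms[OF p k] by (simp add: norm_on_def)
      ultimately show False
        using \<delta>(2)[OF p k] \<delta>(1) by simp
    qed
  qed (fact i ii(1) iv enum v \<rho> | simp add: functionals)+
  let ?rate = "cost_rate A \<phi> b e N c" and ?len = "edge_length A \<phi> b e N"
    and ?best = "best_rate A \<phi> b e N c"
  have rate: "c (adj p k - p) = ?rate p k * ?len p k" if "p \<in> E" "k \<in> idx p" for p k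
    using \<delta>(1) \<delta>(2)[OF that] cost(1) by (simp add: cost_rate_def linear_diff)
  have best_le: "?best p \<le> ereal (?rate p k)" if "k \<in> idx p" for p k
    unfolding best_rate_def using that by (rule INF_lower)
  \<comment> \<open>The minimizer is taken extreme because \<open>viii\<close> bounds the
    functionals only at extreme points.\<close>
  obtain x where x: "x \<in> E" "is_arg_min c (\<lambda>x. x \<in> P) x"
    using extreme_minimizer[OF cost] .
  show ?thesis
  proof (intro exI[of _ x] conjI allI impI)
    show "is_arg_min c (\<lambda>x. x \<in> P) x"
      by (fact x(2))
    fix s L assume run: "simplex_run A \<phi> b e N c s L"
    have step: "simplex_step A \<phi> b e N c (s n) (s (Suc n))" if "enat n < L" for n
      using run that by (simp add: simplex_run_def)
    show sE: "s n \<in> E" if "enat n \<le> L" for n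
      using that
    proof (induction n)
      case 0
      show ?case
        using run by (simp add: simplex_run_def)
    next
      case (Suc n)
      then have "enat n < L"
        by (simp add: Suc_ile_eq)
      then show ?case
        using Suc.IH step[of n] adj_extreme[of "s n"] by (auto simp: simplex_step_def)
    qed
    show "(\<exists>m. L = enat m \<and> 0 \<le> ?best (s m) \<and> is_arg_min c (\<lambda>x. x \<in> P) (s m)) \<or>
      (L = \<infinity> \<and> (\<lambda>n. c (s n)) \<longlonglongrightarrow> c x)"
    proof (cases L)
      case (enat m)
      then have m: "s m \<in> E" "\<nexists>q. simplex_step A \<phi> b e N c (s m) q"
        using sE run by (simp_all add: simplex_run_def)
      \<comment> \<open>By \<open>vii\<close> the infimum is attained, so only its sign can prevent
        a step.\<close>
      then have best: "0 \<le> ?best (s m)"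
        using vii[OF m(1)] by (force simp: simplex_step_def)
      have "0 \<le> c (adj (s m) k - s m)" if k: "k \<in> idx (s m)" for k
      proof -
        have "0 \<le> ?rate (s m) k"
          using order_trans[OF best best_le[OF k]] by simp
        then show ?thesis
          using rate[OF m(1) k] \<delta>(1) \<delta>(2)[OF m(1) k] by simp
      qed
      then have "is_arg_min c (\<lambda>x. x \<in> P) (s m)"
        by (rule optimal_if_no_descent[OF m(1) cost])
      with enat best show ?thesis
        by blast
    next
      case infinity
      have E: "s n \<in> E" for n
        using sE infinity by simp
      \<comment> \<open>With \<open>g\<close> the best rate, the step changes the cost by at most
        \<open>g * \<delta>\<close>, while every edge costs at least
        \<open>\<bar>D\<bar> * g\<close>; eliminating \<open>g\<close> gives the factor
        \<open>\<bar>D\<bar> / \<delta>\<close>. The absolute value supplies the sign that the bound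
        \<open>D\<close> lacks.\<close>
      have descent: "c (s (Suc n)) \<le> c (s n) \<and>
        (\<forall>k\<in>idx (s n). \<bar>D\<bar> / \<delta> * (c (s (Suc n)) - c (s n)) \<le> c (adj (s n) k - s n))" for n
      proof -
        obtain j where j: "j \<in> idx (s n)" "ereal (?rate (s n) j) = ?best (s n)"
          "?best (s n) < 0" "s (Suc n) = adj (s n) j"
          using step[of n] infinity by (auto simp: simplex_step_def)
        define g where "g = ?rate (s n) j"
        have g: "g < 0" "\<And>k. k \<in> idx (s n) \<Longrightarrow> g \<le> ?rate (s n) k"
          using j(2,3) best_le[of _ "s n"] by (auto simp: g_def simp flip: j(2))
        have diff: "c (s (Suc n)) - c (s n) = g * ?len (s n) j"
          using rate[OF E j(1)] j(4) cost(1) by (simp add: g_def linear_diff)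
        also have "\<dots> \<le> g * \<delta>"
          using \<delta>(2)[OF E j(1)] g(1) by (simp add: mult_left_mono_neg)
        finally have le: "(c (s (Suc n)) - c (s n)) / \<delta> \<le> g"
          using \<delta>(1) by (simp add: pos_divide_le_eq)
        have "g * \<delta> \<le> 0"
          using g(1) \<delta>(1) by (simp add: mult_nonpos_nonneg)
        then have "c (s (Suc n)) \<le> c (s n)"
          using \<open>g * ?len (s n) j \<le> g * \<delta>\<close> diff by linarith
        moreover have "\<bar>D\<bar> / \<delta> * (c (s (Suc n)) - c (s n)) \<le> c (adj (s n) k - s n)"
          if k: "k \<in> idx (s n)" for k
        proof -
          have "\<bar>D\<bar> * ((c (s (Suc n)) - c (s n)) / \<delta>) \<le> \<bar>D\<bar> * g"
            using le by (rule mult_left_mono) simp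
          also have "\<dots> \<le> ?len (s n) k * g"
            using D[OF E k] g(1) by (intro mult_right_mono_neg) auto
          also have "\<dots> \<le> ?len (s n) k * ?rate (s n) k"
            using g(2)[OF k] \<delta>(1) \<delta>(2)[OF E k] by (intro mult_left_mono) auto
          finally show ?thesis
            using rate[OF E k] by (simp add: mult.commute)
        qed
        ultimately show ?thesis
          by blast
      qed
      have "(\<lambda>n. c (s n)) \<longlonglongrightarrow> c x"
        by (rule descent_converges[OF cost x M ix E, where \<kappa> = "\<bar>D\<bar> / \<delta>"])
          (use descent \<delta>(1) in auto)
      with infinity show ?thesis
        by blast
    qed
  qed
qed

end
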